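(* Let $n\ge 1$ and let $\Omega=\bigcup_{j=1}^n[a_j,a_j+r_j)\subset\mathbb{R}$ with $r_j>0$, $\sum_{j=1}^n r_j=1$ and $a_j+r_j<a_{j+1}$ for $1\le j<n$. If $\Omega$ is spectral with a spectrum $\Lambda$ such that $0\in\Lambda\subset\Lambda-\Lambda\subset\mathcal{L}$ for some lattice $\mathcal{L}\subset\mathbb{R}$, then $\Lambda$ is rational, i.e. $\Lambda\subset\mathbb{Q}$.
   Context: A set $\Lambda\subset\mathbb{R}$ is a spectrum for a measurable set $\Omega\subset\mathbb{R}$ of finite positive measure if the functions $e_\lambda(x)=|\Omega|^{-1/2}e^{2\pi i\lambda x}\chi_\Omega(x)$, $\lambda\in\Lambda$, form an orthonormal basis of $L^2(\Omega)$; $\Omega$ is spectral if it has a spectrum. $\Lambda-\Lambda=\{\lambda-\lambda':\lambda,\lambda'\in\Lambda\}$. A lattice in $\mathbb{R}$ is a set $\theta\mathbb{Z}$ with $\theta>0$. *)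

theory Defs
  imports "HOL-Analysis.Analysis"
begin

text \<open>Elements of $L^2(M)$ are represented by functions; equality almost everywhere is expressed by
  vanishing of the $L^2$ distance.\<close>

definition L2_space :: "'a measure \<Rightarrow> ('a \<Rightarrow> complex) set" where
  "L2_space M = {f \<in> borel_measurable M. integrable M (\<lambda>x. (cmod (f x))\<^sup>2)}"

definition L2_inner :: "'a measure \<Rightarrow> ('a \<Rightarrow> complex) \<Rightarrow> ('a \<Rightarrow> complex) \<Rightarrow> complex" where
  "L2_inner M f g = (LINT x|M. f x * cnj (g x))"

definition L2_norm :: "'a measure \<Rightarrow> ('a \<Rightarrow> complex) \<Rightarrow> real" where
  "L2_norm M f = sqrt (LINT x|M. (cmod (f x))\<^sup>2)"

text \<open>An orthonormal family whose finite linear combinations are dense in $L^2(M)$.\<close>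

definition orthonormal_basis :: "'a measure \<Rightarrow> 'i set \<Rightarrow> ('i \<Rightarrow> 'a \<Rightarrow> complex) \<Rightarrow> bool" where
  "orthonormal_basis M I e \<longleftrightarrow>
     (\<forall>i\<in>I. e i \<in> L2_space M) \<and>
     (\<forall>i\<in>I. \<forall>j\<in>I. L2_inner M (e i) (e j) = (if i = j then 1 else 0)) \<and>
     (\<forall>f\<in>L2_space M. \<forall>\<epsilon>>0. \<exists>F c. finite F \<and> F \<subseteq> I \<and>
        L2_norm M (\<lambda>x. f x - (\<Sum>i\<in>F. c i * e i x)) < \<epsilon>)"

definition exponential :: "real set \<Rightarrow> real \<Rightarrow> real \<Rightarrow> complex" where
  "exponential \<Omega> \<mu> x =
     of_real (measure lebesgue \<Omega> powr (- 1 / 2)) * exp (2 * pi * \<i> * \<mu> * x) * indicator \<Omega> x"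

definition is_spectrum :: "real set \<Rightarrow> real set \<Rightarrow> bool" where
  "is_spectrum \<Omega> \<Lambda> \<longleftrightarrow>
     \<Omega> \<in> lmeasurable \<and> measure lebesgue \<Omega> > 0 \<and>
     orthonormal_basis (lebesgue_on \<Omega>) \<Lambda> (exponential \<Omega>)"

definition difference_set :: "real set \<Rightarrow> real set" where
  "difference_set \<Lambda> = {x - y |x y. x \<in> \<Lambda> \<and> y \<in> \<Lambda>}"

definition is_lattice :: "real set \<Rightarrow> bool" where
  "is_lattice L \<longleftrightarrow> (\<exists>\<theta>>0. L = {\<theta> * of_int k |k::int. True})"

end

theory Submission
  imports Defs "HOL-Library.Function_Algebras" "HOL-Library.Real_Mod"
    "HOL-Computational_Algebra.Polynomial"
begin

text \<open>Write $e(t) = e^{2\pi i t}$, $b_j = a_j + r_j$ and $S(\xi) = \sum_j (e(\xi b_j) - e(\xi a_j))$. For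
$x \neq y$ the inner product of the exponentials with frequencies $x$ and $y$ is a nonzero multiple
of $S(x - y)$. So $S$ vanishes on $\Lambda - \Lambda$, and by completeness every $y$ with
$S(y - \lambda) = 0$ for all $\lambda \in \Lambda$ already belongs to $\Lambda$. Let the lattice be
$\theta\mathbb{Z}$ and put $A = \{k \in \mathbb{Z} : \theta k \in \Lambda\}$. It suffices to show that
$\theta$ is rational.

The set $A$ contains arithmetic progressions of every length. It has bounded gaps, because $|S|$
is bounded, so the squared coefficients of the exponential of frequency $\theta m$ with respect to
elements of the spectrum far away from it have a small sum, whereas all of them together sum to
$1$. And $A$ is the set of common zeros of exponential sums in $k$ whose frequencies are the $2n$
endpoints of the intervals, so $k \in A$ whenever the vector of the $2n$ numbers $e(\theta k x)$, $x$ an endpoint,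
is in the span of the vectors belonging to elements of $A$. As these spans have dimension at most
$2n$, there is a long stretch of $\mathbb{Z}$ on which the span seen through a window of fixed
width does not depend on the window. If two windows in it show the same pattern, translation by
their distance maps the elements of $A$ in that stretch into $A$
(\<open>syndetic_zero_set_contains_progression\<close>).

A progression of length $2n$ with step $p$ gives, with $d = \theta p$, that $S(jd) = 0$ for $0 \le j < 2n$: the
power sums of exponents below $2n$ of the numbers $e(d b_j)$ and of the numbers $e(d a_j)$ agree.
Hence these are the same numbers with the same multiplicities, and so their products agree
(\<open>prod_eq_if_power_sums_eq\<close>), i.e. $e(d \sum_j r_j) = 1$. Since $\sum_j r_j = 1$, $d$ is an
integer and $\theta = d/p$ is rational.\<close>

section \<open>Progressions in zero sets of exponential sums\<close>

lemma sum_fun_apply: "(\<Sum>i\<in>I. f i) x = (\<Sum>i\<in>I. f i x)" for f :: "_ \<Rightarrow> _ \<Rightarrow> _::comm_monoid_add"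
  by (induction I rule: infinite_finite_induct) auto

lemma (in vector_space) subset_span_if_dim_le:
  assumes "finite T" and "S \<subseteq> T" and "dim T \<le> dim S"
  shows "T \<subseteq> span S"
proof -
  obtain B where B: "B \<subseteq> S" "independent B" "S \<subseteq> span B" "card B = dim S"
    by (rule basis_exists)
  obtain C where C: "B \<subseteq> C" "C \<subseteq> T" "independent C" "T \<subseteq> span C"
    by (rule maximal_independent_subset_extend[of B T]) (use B assms in auto)
  have "finite C" using C(2) assms(1) finite_subset by blast
  have "card C = dim T"
    using C basis_card_eq_dim by blast
  then have "B = C"
    using card_seteq[OF \<open>finite C\<close> C(1)] B(4) assms(3) by simp
  then show ?thesis using C(4) B(1) span_mono by blast
qed

text \<open>Two facts about the vectors $u(k) = (z_i^k)_{i \in I}$ carry the proof: $u(k) \in \mathrm{span}\,u(A)$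
implies $k \in A$, since each exponential sum vanishing on $A$ is a linear functional of $u(k)$; and
linear relations among the $u(k)$ are invariant under translation of $k$. Consider the dimension spanned by a window of
width $W$, minimised over the position of the window. It is nondecreasing in $W$ and bounded by
$|I|$, hence constant from some $W_0$ on. A window of large width $W$ that attains the minimum is
then spanned by each of its subwindows of width $W_0$. By the pigeonhole principle two of these, at
a distance $p \le 2^{W_0}$, show the same pattern of $A$. Translation by $p$ maps the first into
$A$, hence it maps everything spanned by the first, in particular every element of $A$ in the
large window, into $A$. Because $p$ is bounded independently of $W$, the large window can be chosen wide
enough for $N$ such steps, and the gap condition supplies a starting point near its left end.\<close>

lemma syndetic_zero_set_contains_progression:
  fixes z :: "'i \<Rightarrow> 'a::field" and A :: "int set" and R N :: nat
  assumes fin: "finite I" and nz: "\<And>i. i \<in> I \<Longrightarrow> z i \<noteq> 0"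
    and zero_set: "\<And>k. k \<notin> A \<Longrightarrow> \<exists>w. (\<forall>b\<in>A. (\<Sum>i\<in>I. w i * z i powi b) = 0) \<and>
                                  (\<Sum>i\<in>I. w i * z i powi k) \<noteq> 0"
    and gaps: "\<And>m. \<exists>k\<in>A. m \<le> k \<and> k < m + int R"
  shows "\<exists>k p. p > 0 \<and> (\<forall>j<N. k + int j * p \<in> A)"
proof -
  interpret vector_space "\<lambda>(c::'a) (f::'i \<Rightarrow> 'a) i. c * f i"
    by unfold_locales (auto simp: fun_eq_iff algebra_simps)
  define u where "u k = (\<lambda>i. if i \<in> I then z i powi k else 0)" for k
  define win where "win x W = u ` (A \<inter> {x..<x + int W})" for x W
  define unit where "unit i = (\<lambda>j. if j = i then 1 else (0::'a))" for i :: 'i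
  have sub_ker: "subspace {f. (\<Sum>i\<in>I. w i * f i) = 0}" for w :: "'i \<Rightarrow> 'a"
    by (auto simp: subspace_def algebra_simps sum.distrib sum_distrib_left[symmetric])
  have mem_A: "k \<in> A" if "u k \<in> span (u ` A)" for k
  proof (rule ccontr)
    assume "k \<notin> A"
    then obtain w where w: "\<forall>b\<in>A. (\<Sum>i\<in>I. w i * z i powi b) = 0"
      "(\<Sum>i\<in>I. w i * z i powi k) \<noteq> 0" using zero_set by blast
    have eq: "(\<Sum>i\<in>I. w i * u l i) = (\<Sum>i\<in>I. w i * z i powi l)" for l
      by (intro sum.cong) (auto simp: u_def)
    have "span (u ` A) \<subseteq> {f. (\<Sum>i\<in>I. w i * f i) = 0}"
      by (rule span_minimal[OF _ sub_ker]) (use w(1) eq in auto)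
    with that w(2) eq show False by auto
  qed
  have span_shift: "u (k + p) \<in> span (u ` (\<lambda>b. b + p) ` B)" if "u k \<in> span (u ` B)" for k p B
  proof -
    let ?T = "\<lambda>f i. u p i * f i"
    have mult: "u (l + p) = ?T (u l)" for l
      using nz by (auto simp: u_def power_int_add fun_eq_iff)
    have "subspace {f. ?T f \<in> span (u ` (\<lambda>b. b + p) ` B)}"
    proof -
      have "?T 0 = 0" "?T (f + g) = ?T f + ?T g" 
        "?T (\<lambda>i. c * f i) = (\<lambda>i. c * ?T f i)" for f g :: "'i \<Rightarrow> 'a" and c
        by (auto simp: fun_eq_iff algebra_simps)
      then show ?thesis
        by (simp add: subspace_def span_zero span_add span_scale)
    qed
    then have "span (u ` B) \<subseteq> {f. ?T f \<in> span (u ` (\<lambda>b. b + p) ` B)}"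
      by (intro span_minimal) (auto intro!: span_base simp: mult[symmetric])
    with that show ?thesis by (auto simp: mult)
  qed
  have "u k \<in> span (unit ` I)" for k
  proof -
    have "u k = (\<Sum>i\<in>I. (\<lambda>j. u k i * unit i j))"
      using fin by (auto simp: fun_eq_iff unit_def u_def sum_fun_apply if_distrib[of "\<lambda>c. _ * c"] cong: if_cong)
    also have "\<dots> \<in> span (unit ` I)"
      by (intro span_sum span_scale span_base) auto
    finally show ?thesis .
  qed
  then have rank_bound: "dim (win x W) \<le> card I" for x W
    using dim_le_card[of "win x W" "unit ` I"] card_image_le[OF fin, of unit] fin
    by (force simp: win_def)
  define m where "m W = Inf (range (\<lambda>x. dim (win x W)))" for W
  have m_le: "m W \<le> dim (win x W)" for x W
    unfolding m_def by (intro cInf_lower) auto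
  have m_att: "\<exists>x. dim (win x W) = m W" for W
    using Inf_nat_def1[of "range (\<lambda>x. dim (win x W))"] by (auto simp: m_def)
  have "\<forall>W. m W \<le> card I" using m_le rank_bound le_trans by blast
  then obtain W0 where W0: "m W \<le> m W0" for W
    using ex_has_greatest_nat[of "\<lambda>_. True" _ m "Suc (card I)"] by (auto simp: less_Suc_eq_le)
  \<comment> \<open>Room for the first element, for the positions of the subwindows compared, and for the steps of the progression.\<close>
  define W where "W = W0 + R + (N + 1) * 2 ^ W0"
  obtain x where x: "dim (win x W) = m W" using m_att by blast
  define pat where "pat t = {s \<in> {0..<int W0}. x + int t + s \<in> A}" for t :: nat
  have "\<not> inj_on pat {0..2 ^ W0}"
  proof
    assume "inj_on pat {0..2 ^ W0}"
    moreover have "pat ` {0..2 ^ W0} \<subseteq> Pow {0..<int W0}" by (auto simp: pat_def)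
    ultimately have "card {0..(2::nat) ^ W0} \<le> card (Pow {0..<int W0})"
      by (intro card_inj_on_le) auto
    then show False by (simp add: card_Pow)
  qed
  then obtain s s' where "s \<le> 2 ^ W0" "s' \<le> 2 ^ W0" "pat s = pat s'" "s \<noteq> s'"
    unfolding inj_on_def by auto
  then obtain t t' where t: "t < t'" "t' \<le> 2 ^ W0" "pat t = pat t'"
    by (cases s s' rule: linorder_cases) auto
  define y where "y = x + int t"
  define p where "p = int t' - int t"
  have "int t' \<le> 2 ^ W0"
    using of_nat_mono[OF t(2), where 'a = int] unfolding of_nat_power of_nat_numeral .
  then have p: "0 < p" "p \<le> 2 ^ W0" using t(1) unfolding p_def by linarith+
  have tW: "int t + int W0 \<le> int W"
  proof -
    have "t + W0 \<le> W" using t by (simp add: W_def)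
    then show ?thesis by linarith
  qed
  have "win y W0 \<subseteq> win x W" using tW by (force simp: win_def y_def)
  moreover have "finite (win x W)" by (simp add: win_def)
  moreover have "dim (win x W) \<le> dim (win y W0)" using x W0 m_le le_trans by metis
  ultimately have wsub: "win x W \<subseteq> span (win y W0)" by (intro subset_span_if_dim_le)
  have shifted: "b + p \<in> A" if "b \<in> A \<inter> {y..<y + int W0}" for b
  proof -
    have "b - y \<in> pat t" using that by (auto simp: pat_def y_def)
    then have "b - y \<in> pat t'" using t by simp
    then show ?thesis by (simp add: pat_def y_def p_def algebra_simps)
  qed
  \<comment> \<open>The subwindow at y spans the large window and its translate by p is in A, so p translates the large window into A.\<close>
  have step: "k + p \<in> A" if "k \<in> A" "x \<le> k" "k < x + int W" for k
  proof -
    have "u k \<in> span (u ` (A \<inter> {y..<y + int W0}))" using wsub that by (auto simp: win_def)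
    from span_shift[OF this, of p] have "u (k + p) \<in> span (u ` A)"
      using span_mono[of "u ` (\<lambda>b. b + p) ` (A \<inter> {y..<y + int W0})" "u ` A"] shifted by blast
    then show ?thesis by (rule mem_A)
  qed
  obtain k where k: "k \<in> A" "x \<le> k" "k < x + int R" using gaps by blast
  have "k + int j * p \<in> A" if "j < N" for j
    using that
  proof (induction j)
    case 0 then show ?case using k by simp
  next
    case (Suc j)
    have "int j * p \<le> int N * 2 ^ W0" using p Suc.prems by (intro mult_mono) auto
    moreover have "int W = int W0 + int R + int N * 2 ^ W0 + 2 ^ W0" by (simp add: W_def algebra_simps)
    moreover have "(0::int) < 2 ^ W0" by simp
    ultimately have "k + int j * p < x + int W" using k by linarith
    moreover have "x \<le> k + int j * p" using k p by (simp add: add_increasing2)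
    ultimately have "k + int j * p + p \<in> A" using Suc step by simp
    then show ?case by (simp add: algebra_simps)
  qed
  with p show ?thesis by blast
qed

section \<open>Power sums determine products\<close>

text \<open>At most $2|I|$ distinct values occur, so the polynomial that vanishes at all of them except
$\zeta$ has degree below $2|I|$. Its sums over the two families agree by assumption, and up to a common
nonzero factor they count how often each family takes the value $\zeta$. In characteristic $0$
the counts are therefore equal as natural numbers.\<close>

lemma prod_eq_if_power_sums_eq:
  fixes f g :: "'i \<Rightarrow> 'a::field_char_0"
  assumes fin: "finite I" and eq: "\<And>k. k < 2 * card I \<Longrightarrow> (\<Sum>i\<in>I. f i ^ k) = (\<Sum>i\<in>I. g i ^ k)"
  shows "prod f I = prod g I"
proof -
  define Z where "Z = f ` I \<union> g ` I"
  have finZ: "finite Z" and cardZ: "card Z \<le> 2 * card I"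
    using fin card_Un_le[of "f ` I" "g ` I"] card_image_le[OF fin, of f] card_image_le[OF fin, of g]
    by (auto simp: Z_def)
  have count: "card {i \<in> I. f i = \<zeta>} = card {i \<in> I. g i = \<zeta>}" if "\<zeta> \<in> Z" for \<zeta>
  proof -
    define P where "P = (\<Prod>w\<in>Z - {\<zeta>}. [:- w, 1:])"
    have "degree P = card (Z - {\<zeta>})"
      unfolding P_def by (subst degree_prod_eq_sum_degree) auto
    moreover have "card (Z - {\<zeta>}) < card Z" using finZ that by (intro psubset_card_mono) auto
    ultimately have deg: "degree P < 2 * card I" using cardZ by linarith
    have P0: "poly P w = 0" if "w \<in> Z" "w \<noteq> \<zeta>" for w
      using that finZ by (auto simp: P_def poly_prod)
    have P1: "poly P \<zeta> \<noteq> 0" using finZ by (auto simp: P_def poly_prod)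
    have ex: "(\<Sum>i\<in>I. poly P (h i)) = (\<Sum>k\<le>degree P. coeff P k * (\<Sum>i\<in>I. h i ^ k))" for h
      by (subst poly_altdef, subst sum.swap) (simp add: sum_distrib_left)
    have cnt: "(\<Sum>i\<in>I. poly P (h i)) = of_nat (card {i \<in> I. h i = \<zeta>}) * poly P \<zeta>" if "h ` I \<subseteq> Z" for h
    proof -
      have "(\<Sum>i\<in>I. poly P (h i)) = (\<Sum>i\<in>{i \<in> I. h i = \<zeta>}. poly P (h i))"
        using fin that by (intro sum.mono_neutral_right) (auto intro: P0)
      then show ?thesis by simp
    qed
    have "(\<Sum>i\<in>I. poly P (f i)) = (\<Sum>i\<in>I. poly P (g i))"
      unfolding ex using deg by (intro sum.cong refl) (simp add: eq)
    with P1 show ?thesis by (simp add: cnt Z_def)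
  qed
  have "prod h I = (\<Prod>\<zeta>\<in>Z. \<zeta> ^ card {i \<in> I. h i = \<zeta>})" if "h ` I \<subseteq> Z" for h
    by (subst prod.group[OF fin finZ that, symmetric]) simp
  then show ?thesis using count by (simp add: Z_def)
qed

section \<open>Spectra of unions of intervals\<close>

lemma square_summable_tail:
  fixes e :: real
  assumes "e > 0"
  shows "\<exists>R::nat. \<forall>D::int set. finite D \<longrightarrow> (\<forall>d\<in>D. int R \<le> \<bar>d\<bar>) \<longrightarrow> (\<Sum>d\<in>D. 1 / (of_int d)\<^sup>2) < e"
proof -
  have "summable (\<lambda>k. 1 / (real k)\<^sup>2)"
    using inverse_power_summable[of 2, where 'a = real] by (simp add: field_simps)
  then obtain R where R: "\<And>m n. m \<ge> R \<Longrightarrow> norm (\<Sum>k\<in>{m..<n}. 1 / (real k)\<^sup>2) < e / 2"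
    unfolding summable_Cauchy using half_gt_zero[OF assms] by meson
  have half: "(\<Sum>d\<in>D. 1 / (of_int d)\<^sup>2) < e / 2"
    if D: "finite D" "inj_on (\<lambda>d. nat \<bar>d\<bar>) D" "\<forall>d\<in>D. int R \<le> \<bar>d\<bar>" for D :: "int set"
  proof -
    define n where "n = Suc (\<Sum>d\<in>D. nat \<bar>d\<bar>)"
    have "(\<Sum>d\<in>D. 1 / (of_int d)\<^sup>2) = (\<Sum>k\<in>(\<lambda>d. nat \<bar>d\<bar>) ` D. 1 / (real k)\<^sup>2)"
      using D by (subst sum.reindex) auto
    also have "\<dots> \<le> (\<Sum>k\<in>{R..<n}. 1 / (real k)\<^sup>2)"
    proof (rule sum_mono2)
      show "(\<lambda>d. nat \<bar>d\<bar>) ` D \<subseteq> {R..<n}"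
        using D member_le_sum[of _ D "\<lambda>d. nat \<bar>d\<bar>"] by (force simp: n_def less_Suc_eq_le)
    qed auto
    also have "\<dots> < e / 2" using R[of R n] by simp
    finally show ?thesis .
  qed
  show ?thesis
  proof (intro exI allI impI)
    fix D :: "int set" assume D: "finite D" "\<forall>d\<in>D. int R \<le> \<bar>d\<bar>"
    have "(\<Sum>d\<in>D. 1 / (real_of_int d)\<^sup>2)
        = (\<Sum>d\<in>D \<inter> {0..}. 1 / (of_int d)\<^sup>2) + (\<Sum>d\<in>D - {0..}. 1 / (of_int d)\<^sup>2)"
      using D by (intro sum.Int_Diff)
    also have "\<dots> < e / 2 + e / 2"
      using D by (intro add_strict_mono half) (auto simp: inj_on_def)
    finally show "(\<Sum>d\<in>D. 1 / (real_of_int d)\<^sup>2) < e" by simp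
  qed
qed

lemma L2_product_integrable:
  assumes "f \<in> L2_space M" "g \<in> L2_space M"
  shows "integrable M (\<lambda>x. f x * cnj (g x))"
proof (rule Bochner_Integration.integrable_bound)
  show "integrable M (\<lambda>x. (cmod (f x))\<^sup>2 + (cmod (g x))\<^sup>2)"
    using assms by (auto simp: L2_space_def)
  have [measurable]: "f \<in> borel_measurable M" "g \<in> borel_measurable M"
    using assms by (auto simp: L2_space_def)
  have [measurable]: "cnj \<in> borel_measurable borel"
    by (intro borel_measurable_continuous_onI continuous_intros)
  show "(\<lambda>x. f x * cnj (g x)) \<in> borel_measurable M" by measurable
  have "cmod (f x) * cmod (g x) \<le> (cmod (f x))\<^sup>2 + (cmod (g x))\<^sup>2" for x
  proof -
    have "0 \<le> (cmod (f x) - cmod (g x))\<^sup>2 + (cmod (f x))\<^sup>2 + (cmod (g x))\<^sup>2" by simp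
    then show ?thesis by (simp add: power2_eq_square algebra_simps)
  qed
  then show "AE x in M. norm (f x * cnj (g x)) \<le> norm ((cmod (f x))\<^sup>2 + (cmod (g x))\<^sup>2)"
    by (simp add: norm_mult)
qed

text \<open>Parseval's identity up to $\epsilon$, for finite subsets of the basis: no linear combination
of finitely many orthonormal vectors is closer to $f$ than the one whose coefficients are the
inner products, and the square of that distance is the defect in Bessel's inequality.\<close>

lemma orthonormal_basis_defect:
  assumes "orthonormal_basis M I e" "f \<in> L2_space M" "\<epsilon> > 0"
  shows "\<exists>F. finite F \<and> F \<subseteq> I \<and>
           (LINT x|M. (cmod (f x))\<^sup>2) < (\<Sum>i\<in>F. (cmod (L2_inner M f (e i)))\<^sup>2) + \<epsilon>"
proof -
  have "sqrt \<epsilon> > 0" using assms by simp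
  then obtain F c where F: "finite F" "F \<subseteq> I"
    and less: "L2_norm M (\<lambda>x. f x - (\<Sum>i\<in>F. c i * e i x)) < sqrt \<epsilon>"
    using assms unfolding orthonormal_basis_def by meson
  have e: "e i \<in> L2_space M" if "i \<in> F" for i
    using that F assms by (auto simp: orthonormal_basis_def)
  have orth: "(LINT x|M. e i x * cnj (e j x)) = (if i = j then 1 else 0)" if "i \<in> F" "j \<in> F" for i j
    using that F assms by (auto simp: orthonormal_basis_def L2_inner_def subset_iff)
  define \<alpha> where "\<alpha> i = L2_inner M f (e i)" for i
  have ife: "integrable M (\<lambda>x. f x * cnj (e i x))" if "i \<in> F" for i
    using that e assms by (intro L2_product_integrable)
  have ief: "integrable M (\<lambda>x. e i x * cnj (f x))" if "i \<in> F" for i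
    using that e assms by (intro L2_product_integrable)
  have iee: "integrable M (\<lambda>x. e i x * cnj (e j x))" if "i \<in> F" "j \<in> F" for i j
    using that e by (intro L2_product_integrable)
  have iff: "integrable M (\<lambda>x. f x * cnj (f x))"
    using assms by (intro L2_product_integrable)
  have \<alpha>': "(LINT x|M. e i x * cnj (f x)) = cnj (\<alpha> i)" for i
    unfolding \<alpha>_def L2_inner_def by (simp add: mult.commute flip: Bochner_Integration.integral_cnj)
  let ?D = "LINT x|M. (cmod (f x - (\<Sum>i\<in>F. c i * e i x)))\<^sup>2"
  have "complex_of_real ?D =
      (LINT x|M. f x * cnj (f x) - (\<Sum>i\<in>F. cnj (c i) * (f x * cnj (e i x)))
        - (\<Sum>i\<in>F. c i * (e i x * cnj (f x))) + (\<Sum>i\<in>F. \<Sum>j\<in>F. c i * cnj (c j) * (e i x * cnj (e j x))))"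
    unfolding integral_complex_of_real[symmetric]
    by (intro Bochner_Integration.integral_cong refl, unfold complex_norm_square)
       (simp add: algebra_simps sum_product sum_distrib_left sum_distrib_right, rule sum.swap)
  also have "\<dots> = (LINT x|M. f x * cnj (f x)) - (\<Sum>i\<in>F. cnj (c i) * \<alpha> i) - (\<Sum>i\<in>F. c i * cnj (\<alpha> i))
       + (\<Sum>i\<in>F. \<Sum>j\<in>F. c i * cnj (c j) * (if i = j then 1 else 0))"
    using ife ief iee iff by (simp add: \<alpha>_def[unfolded L2_inner_def, symmetric] \<alpha>' orth
        Bochner_Integration.integrable_sum Bochner_Integration.integral_sum)
  also have "(\<Sum>i\<in>F. \<Sum>j\<in>F. c i * cnj (c j) * (if i = j then 1 else 0)) = (\<Sum>i\<in>F. c i * cnj (c i))"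
    using F by (simp add: if_distrib[of "\<lambda>t. _ * t"] cong: if_cong)
  also have "(LINT x|M. f x * cnj (f x)) = of_real (LINT x|M. (cmod (f x))\<^sup>2)"
    by (simp only: integral_complex_of_real[symmetric] complex_norm_square)
  \<comment> \<open>Completing the square in each coefficient.\<close>
  finally have "complex_of_real ?D =
     of_real ((LINT x|M. (cmod (f x))\<^sup>2) - (\<Sum>i\<in>F. (cmod (\<alpha> i))\<^sup>2) + (\<Sum>i\<in>F. (cmod (c i - \<alpha> i))\<^sup>2))"
    by (simp only: of_real_add of_real_diff of_real_sum complex_norm_square)
       (simp add: algebra_simps sum.distrib sum_subtractf)
  then have D: "?D = (LINT x|M. (cmod (f x))\<^sup>2) - (\<Sum>i\<in>F. (cmod (\<alpha> i))\<^sup>2) + (\<Sum>i\<in>F. (cmod (c i - \<alpha> i))\<^sup>2)"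
    by (simp only: of_real_eq_iff)
  have "?D < \<epsilon>" using less by (simp add: L2_norm_def)
  moreover have "0 \<le> (\<Sum>i\<in>F. (cmod (c i - \<alpha> i))\<^sup>2)" by (simp add: sum_nonneg)
  ultimately show ?thesis using F D unfolding \<alpha>_def by (intro exI[of _ F]) linarith
qed

locale spectral_intervals =
  fixes n :: nat and a r :: "nat \<Rightarrow> real" and \<Omega> \<Lambda> :: "real set"
  assumes \<Omega>_eq: "\<Omega> = (\<Union>j\<in>{1..n}. {a j ..< a j + r j})"
    and r_pos: "\<And>j. 1 \<le> j \<Longrightarrow> j \<le> n \<Longrightarrow> r j > 0"
    and r_sum: "(\<Sum>j=1..n. r j) = 1"
    and separated: "\<And>j. 1 \<le> j \<Longrightarrow> j < n \<Longrightarrow> a j + r j < a (j + 1)"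
    and spectrum: "is_spectrum \<Omega> \<Lambda>"
begin

lemma intervals_ordered:
  assumes "1 \<le> i" "i < j" "j \<le> n"
  shows "a i + r i \<le> a j"
  using assms(2,3)
proof (induction j)
  case (Suc j)
  have "a j + r j \<le> a (Suc j)" if "1 \<le> j" using separated[of j] that Suc.prems by simp
  moreover have "a j \<le> a j + r j" if "1 \<le> j" using r_pos[of j] that Suc.prems by simp
  ultimately show ?case using Suc assms(1) by (cases "i = j") fastforce+
qed simp

lemma has_integral_antiderivative:
  fixes F :: "real \<Rightarrow> 'b::banach"
  assumes "\<And>x. (F has_vector_derivative f x) (at x)"
  shows "(f has_integral (\<Sum>j=1..n. F (a j + r j) - F (a j))) \<Omega>"
  unfolding \<Omega>_eq
proof (rule has_integral_UN)
  fix j assume j: "j \<in> {1..n}"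
  have "(f has_integral (F (a j + r j) - F (a j))) {a j..a j + r j}"
    using r_pos[of j] j assms
    by (intro fundamental_theorem_of_calculus) (auto intro: has_vector_derivative_at_within)
  moreover have "negligible {a j + r j}" by simp
  ultimately show "(f has_integral (F (a j + r j) - F (a j))) {a j..<a j + r j}"
    by (subst has_integral_spike_set_eq[where T = "{a j..a j + r j}"])
       (auto intro: negligible_subset[of "{a j + r j}"])
next
  have "{a i..<a i + r i} \<inter> {a j..<a j + r j} = {}" if "i < j" "1 \<le> i" "j \<le> n" for i j
    using intervals_ordered[of i j] that by auto
  then have "{a i..<a i + r i} \<inter> {a j..<a j + r j} = {}" if "i \<noteq> j" "i \<in> {1..n}" "j \<in> {1..n}" for i j
    using that by (cases i j rule: linorder_cases) (auto simp: Int_commute)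
  then show "pairwise (\<lambda>i j. negligible ({a i..<a i + r i} \<inter> {a j..<a j + r j})) {1..n}"
    unfolding pairwise_def by (metis negligible_empty)
qed simp

lemma \<Omega>_lmeasurable: "\<Omega> \<in> lmeasurable"
  using spectrum by (simp add: is_spectrum_def)

lemma measure_\<Omega>: "measure lebesgue \<Omega> = 1"
proof -
  have "((\<lambda>x. 1::real) has_integral (\<Sum>j=1..n. (a j + r j) - a j)) \<Omega>"
    by (rule has_integral_antiderivative) (auto intro!: derivative_eq_intros)
  then show ?thesis
    using lmeasure_integral[OF \<Omega>_lmeasurable] r_sum by (simp add: integral_unique)
qed

lemma exponential_eq: "exponential \<Omega> \<mu> x = cis (2 * pi * \<mu> * x) * indicator \<Omega> x"
  by (simp add: exponential_def measure_\<Omega> cis_conv_exp mult_ac)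

lemma cis_integrable: "integrable (lebesgue_on \<Omega>) (\<lambda>x. cis (c * x))"
proof (rule finite_measure.integrable_const_bound)
  show "finite_measure (lebesgue_on \<Omega>)"
    using \<Omega>_lmeasurable by (simp add: finite_measure_lebesgue_on)
  show "(\<lambda>x. cis (c * x)) \<in> borel_measurable (lebesgue_on \<Omega>)"
    using \<Omega>_lmeasurable
    by (intro continuous_imp_measurable_on_sets_lebesgue continuous_intros) (auto simp: fmeasurableD)
qed (auto intro!: AE_I2)

lemma exponential_L2: "exponential \<Omega> \<mu> \<in> L2_space (lebesgue_on \<Omega>)"
proof -
  have "exponential \<Omega> \<mu> \<in> borel_measurable (lebesgue_on \<Omega>)"
    using borel_measurable_integrable[OF cis_integrable[of "2 * pi * \<mu>"]]
    by (subst measurable_cong[where g = "\<lambda>x. cis (2 * pi * \<mu> * x)"]) (auto simp: exponential_eq)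
  moreover have "integrable (lebesgue_on \<Omega>) (\<lambda>x. (cmod (exponential \<Omega> \<mu> x))\<^sup>2)"
    using integrable_norm[OF cis_integrable[of 0]]
    by (subst Bochner_Integration.integrable_cong[where g = "\<lambda>x. norm (cis (0 * x))"])
       (auto simp: exponential_eq norm_mult)
  ultimately show ?thesis by (simp add: L2_space_def)
qed

text \<open>Up to the factor $2\pi i\xi$ this is the Fourier transform of the indicator function of $\Omega$ at
$-\xi$. With that factor it becomes an exponential sum in $\xi$, and it vanishes also at $0$, so
that orthogonality makes it vanish on all of $\Lambda - \Lambda$.\<close>

definition boundary_sum :: "real \<Rightarrow> complex" where
  "boundary_sum \<xi> = (\<Sum>j=1..n. cis (2 * pi * \<xi> * (a j + r j)) - cis (2 * pi * \<xi> * a j))"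

lemma boundary_sum_0 [simp]: "boundary_sum 0 = 0"
  by (simp add: boundary_sum_def)

lemma norm_boundary_sum: "cmod (boundary_sum \<xi>) \<le> 2 * real n"
proof -
  have "cmod (boundary_sum \<xi>) \<le> (\<Sum>j=1..n. cmod (cis (2 * pi * \<xi> * (a j + r j)) - cis (2 * pi * \<xi> * a j)))"
    unfolding boundary_sum_def by (rule norm_sum)
  also have "\<dots> \<le> (\<Sum>j=1..n. 2)"
    by (intro sum_mono order_trans[OF norm_triangle_ineq4]) simp
  finally show ?thesis by simp
qed

lemma inner_exponentials:
  assumes "x \<noteq> y"
  shows "L2_inner (lebesgue_on \<Omega>) (exponential \<Omega> x) (exponential \<Omega> y)
       = boundary_sum (x - y) / (2 * pi * (x - y) * \<i>)"
proof -
  define \<xi> where "\<xi> = x - y"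
  have \<xi>: "\<xi> \<noteq> 0" using assms by (simp add: \<xi>_def)
  let ?F = "\<lambda>t. cis (2 * pi * \<xi> * t) / (2 * pi * \<xi> * \<i>)"
  have "(?F has_vector_derivative cis (2 * pi * \<xi> * t)) (at t)" for t
  proof -
    define c where "c = 2 * pi * \<xi> * \<i>"
    have "c \<noteq> 0" using \<xi> by (simp add: c_def)
    then have "((\<lambda>s. exp (c * s) / c) has_field_derivative exp (c * of_real t)) (at (of_real t))"
      by (auto intro!: derivative_eq_intros)
    from has_vector_derivative_real_field[OF this] show ?thesis
      by (simp add: cis_conv_exp c_def mult_ac)
  qed
  from has_integral_antiderivative[OF this]
  have int: "integral \<Omega> (\<lambda>t. cis (2 * pi * \<xi> * t)) = boundary_sum \<xi> / (2 * pi * \<xi> * \<i>)"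
    by (simp add: integral_unique boundary_sum_def diff_divide_distrib sum_divide_distrib)
  have "L2_inner (lebesgue_on \<Omega>) (exponential \<Omega> x) (exponential \<Omega> y)
      = (LINT t|lebesgue_on \<Omega>. cis (2 * pi * \<xi> * t))"
    unfolding L2_inner_def
    by (intro Bochner_Integration.integral_cong) 
       (auto simp: exponential_eq \<xi>_def cis_cnj cis_mult algebra_simps)
  also have "\<dots> = integral \<Omega> (\<lambda>t. cis (2 * pi * \<xi> * t))"
    using \<Omega>_lmeasurable by (intro lebesgue_integral_eq_integral cis_integrable) (auto simp: fmeasurableD)
  finally show ?thesis using int by (simp add: \<xi>_def)
qed

lemma norm_exponential: "(LINT x|lebesgue_on \<Omega>. (cmod (exponential \<Omega> \<mu> x))\<^sup>2) = 1"
proof -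
  have "(LINT x|lebesgue_on \<Omega>. (cmod (exponential \<Omega> \<mu> x))\<^sup>2) = (LINT x|lebesgue_on \<Omega>. 1)"
    by (intro Bochner_Integration.integral_cong) (auto simp: exponential_eq norm_mult)
  also have "\<dots> = 1"
    using measure_\<Omega> \<Omega>_lmeasurable by (simp add: measure_restrict_space fmeasurableD)
  finally show ?thesis .
qed

lemma boundary_sum_difference:
  assumes "x \<in> \<Lambda>" "y \<in> \<Lambda>"
  shows "boundary_sum (x - y) = 0"
proof (cases "x = y")
  case False
  then have "L2_inner (lebesgue_on \<Omega>) (exponential \<Omega> x) (exponential \<Omega> y) = 0"
    using spectrum assms by (simp add: is_spectrum_def orthonormal_basis_def)
  then show ?thesis using False by (simp add: inner_exponentials)
qed simp

text \<open>The squared coefficients of the exponential of frequency $y$ sum to its squared norm $1$; any bound below $1$ would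
serve in place of $1/2$. For a frequency $y$ outside the spectrum this excludes that all
coefficients vanish and, on a lattice, that all elements of the spectrum are far from $y$.\<close>

lemma large_coefficients:
  assumes "y \<notin> \<Lambda>"
  shows "\<exists>F. finite F \<and> F \<subseteq> \<Lambda> \<and>
           1 / 2 < (\<Sum>\<mu>\<in>F. (cmod (boundary_sum (y - \<mu>)) / (2 * pi * (y - \<mu>)))\<^sup>2)"
proof -
  have "orthonormal_basis (lebesgue_on \<Omega>) \<Lambda> (exponential \<Omega>)"
    using spectrum by (simp add: is_spectrum_def)
  from orthonormal_basis_defect[OF this exponential_L2[of y], of "1/2"]
  obtain F where F: "finite F" "F \<subseteq> \<Lambda>"
    and less: "1 < (\<Sum>\<mu>\<in>F. (cmod (L2_inner (lebesgue_on \<Omega>) (exponential \<Omega> y) (exponential \<Omega> \<mu>)))\<^sup>2) + 1/2"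
    by (auto simp: norm_exponential)
  have "(\<Sum>\<mu>\<in>F. (cmod (L2_inner (lebesgue_on \<Omega>) (exponential \<Omega> y) (exponential \<Omega> \<mu>)))\<^sup>2)
      = (\<Sum>\<mu>\<in>F. (cmod (boundary_sum (y - \<mu>)) / (2 * pi * (y - \<mu>)))\<^sup>2)"
  proof (intro sum.cong refl)
    fix \<mu> assume "\<mu> \<in> F"
    then have "y \<noteq> \<mu>" using F assms by auto
    then show "(cmod (L2_inner (lebesgue_on \<Omega>) (exponential \<Omega> y) (exponential \<Omega> \<mu>)))\<^sup>2
        = (cmod (boundary_sum (y - \<mu>)) / (2 * pi * (y - \<mu>)))\<^sup>2"
      by (simp add: inner_exponentials norm_divide norm_mult power_divide power_mult_distrib flip: of_real_diff)
  qed
  with less F show ?thesis by (intro exI[of _ F]) auto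
qed

lemma spectrum_maximal:
  assumes "\<And>\<mu>. \<mu> \<in> \<Lambda> \<Longrightarrow> boundary_sum (y - \<mu>) = 0"
  shows "y \<in> \<Lambda>"
proof (rule ccontr)
  assume "y \<notin> \<Lambda>"
  then obtain F where "F \<subseteq> \<Lambda>" "1 / 2 < (\<Sum>\<mu>\<in>F. (cmod (boundary_sum (y - \<mu>)) / (2 * pi * (y - \<mu>)))\<^sup>2)"
    using large_coefficients by blast
  moreover from this have "(\<Sum>\<mu>\<in>F. (cmod (boundary_sum (y - \<mu>)) / (2 * pi * (y - \<mu>)))\<^sup>2) = 0"
    using assms by (intro sum.neutral) auto
  ultimately show False by simp
qed

text \<open>The coefficient of the exponential of frequency $\theta m$ at an element $\theta(m - d)$ of the
spectrum is at most $n / (\pi\theta |d|)$ in absolute value. If only large $|d|$ occurred, the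
squares could not reach the sum $1/2$.\<close>

lemma spectrum_bounded_gaps:
  assumes \<theta>: "\<theta> > 0" and lattice: "\<Lambda> \<subseteq> range (\<lambda>k::int. \<theta> * of_int k)"
  shows "\<exists>R::nat. \<forall>m::int. \<exists>k. \<theta> * of_int k \<in> \<Lambda> \<and> m \<le> k \<and> k < m + int R"
proof -
  define C where "C = (n / (pi * \<theta>))\<^sup>2"
  have C0: "C \<ge> 0" by (simp add: C_def)
  obtain R :: nat where R: "\<And>D::int set. finite D \<Longrightarrow> (\<forall>d\<in>D. int R \<le> \<bar>d\<bar>) \<Longrightarrow>
      (\<Sum>d\<in>D. 1 / (of_int d)\<^sup>2) < 1 / (2 * C + 1)"
    using square_summable_tail[of "1 / (2 * C + 1)"] C0 by (auto simp: add_nonneg_pos)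
  have near: "\<exists>k. \<theta> * of_int k \<in> \<Lambda> \<and> \<bar>k - m\<bar> \<le> int R" for m :: int
  proof (rule ccontr)
    assume far: "\<nexists>k. \<theta> * of_int k \<in> \<Lambda> \<and> \<bar>k - m\<bar> \<le> int R"
    then have "\<theta> * of_int m \<notin> \<Lambda>" by force
    then obtain F where F: "finite F" "F \<subseteq> \<Lambda>"
      and big: "1 / 2 < (\<Sum>\<mu>\<in>F. (cmod (boundary_sum (\<theta> * of_int m - \<mu>)) / (2 * pi * (\<theta> * of_int m - \<mu>)))\<^sup>2)"
      using large_coefficients by blast
    define D where "D = {d. \<theta> * of_int (m - d) \<in> F}"
    have inj: "inj (\<lambda>d. \<theta> * of_int (m - d))" using \<theta> by (auto simp: inj_def)
    have finD: "finite D" unfolding D_def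
      using finite_vimageI[OF F(1) inj] by (simp add: vimage_def)
    have img: "F = (\<lambda>d. \<theta> * of_int (m - d)) ` D"
    proof -
      have "\<mu> \<in> (\<lambda>d. \<theta> * of_int (m - d)) ` D" if "\<mu> \<in> F" for \<mu>
      proof -
        have "\<mu> \<in> range (\<lambda>k::int. \<theta> * of_int k)" using that F lattice by blast
        then obtain k :: int where "\<mu> = \<theta> * of_int k" by blast
        with that show ?thesis by (intro image_eqI[of _ _ "m - k"]) (auto simp: D_def)
      qed
      then show ?thesis by (auto simp: D_def)
    qed
    have "1 / 2 < (\<Sum>d\<in>D. (cmod (boundary_sum (\<theta> * of_int d)) / (2 * pi * (\<theta> * of_int d)))\<^sup>2)"
      using big unfolding img
      by (subst (asm) sum.reindex) (use inj in \<open>auto intro: inj_on_subset simp: algebra_simps\<close>)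
    also have "\<dots> \<le> (\<Sum>d\<in>D. C * (1 / (of_int d)\<^sup>2))"
    proof (rule sum_mono)
      fix d
      have "(cmod (boundary_sum (\<theta> * of_int d)) / (2 * pi * (\<theta> * of_int d)))\<^sup>2
          = (cmod (boundary_sum (\<theta> * of_int d)))\<^sup>2 / (2 * pi * (\<theta> * of_int d))\<^sup>2"
        by (simp add: power_divide)
      also have "\<dots> \<le> (2 * real n)\<^sup>2 / (2 * pi * (\<theta> * of_int d))\<^sup>2"
        by (intro divide_right_mono power_mono norm_boundary_sum) auto
      also have "\<dots> = C * (1 / (of_int d)\<^sup>2)"
        by (simp add: C_def power_divide power_mult_distrib)
      finally show "(cmod (boundary_sum (\<theta> * of_int d)) / (2 * pi * (\<theta> * of_int d)))\<^sup>2
          \<le> C * (1 / (of_int d)\<^sup>2)" .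
    qed
    also have "\<dots> = C * (\<Sum>d\<in>D. 1 / (of_int d)\<^sup>2)" by (rule sum_distrib_left[symmetric])
    also have "\<dots> \<le> C * (1 / (2 * C + 1))"
    proof -
      have "int R \<le> \<bar>d\<bar>" if "d \<in> D" for d
      proof (rule ccontr)
        assume "\<not> int R \<le> \<bar>d\<bar>"
        then have "\<bar>(m - d) - m\<bar> \<le> int R" by simp
        moreover have "\<theta> * of_int (m - d) \<in> \<Lambda>" using that F by (auto simp: D_def)
        ultimately show False using far by blast
      qed
      then show ?thesis using R[OF finD] C0 by (intro mult_left_mono) (auto intro: less_imp_le)
    qed
    also have "\<dots> \<le> 1 / 2" using C0 by (simp add: field_simps)
    finally show False by simp
  qed
  have "\<exists>k. \<theta> * of_int k \<in> \<Lambda> \<and> m \<le> k \<and> k < m + int (2 * R + 1)" for m :: int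
    using near[of "m + int R"] by (force simp: abs_le_iff)
  then show ?thesis by blast
qed

text \<open>The endpoints of the intervals are indexed by pairs of an interval and a choice of side, and
\<open>z\<close> lists the corresponding numbers $e(\theta x)$. The weights \<open>w l\<close> make
$\sum_i w_i z_i^k$ equal to $S(\theta k - \theta l)$, so that the common zeros over all $l$ with
$\theta l \in \Lambda$ are exactly the $k$ with $\theta k \in \Lambda$.\<close>

lemma lattice_step_rational:
  assumes \<theta>: "\<theta> > 0" and lattice: "\<Lambda> \<subseteq> range (\<lambda>k::int. \<theta> * of_int k)"
  shows "\<theta> \<in> \<rat>"
proof -
  define A where "A = {k::int. \<theta> * of_int k \<in> \<Lambda>}"
  define I where "I = {1..n} \<times> (UNIV :: bool set)"
  define z where "z = (\<lambda>(j, s). cis (2 * pi * \<theta> * (if s then a j + r j else a j)))"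
  define w where "w k = (\<lambda>(j, s). (if s then 1 else - 1) * z (j, s) powi (- k))" for k
  have powz: "z (j, s) powi k = cis (2 * pi * (\<theta> * of_int k) * (if s then a j + r j else a j))" for j s k
    by (simp add: z_def cis_power_int mult_ac)
  have sum_w: "(\<Sum>i\<in>I. w l i * z i powi k) = boundary_sum (\<theta> * of_int k - \<theta> * of_int l)" for k l
    unfolding I_def sum.cartesian_product'
    by (simp add: w_def powz boundary_sum_def UNIV_bool cis_mult algebra_simps
         del: of_int_minus) (simp add: algebra_simps)
  obtain R :: nat where "\<forall>m::int. \<exists>k. \<theta> * of_int k \<in> \<Lambda> \<and> m \<le> k \<and> k < m + int R"
    using spectrum_bounded_gaps[OF assms] by blast
  then have gaps: "\<exists>k\<in>A. m \<le> k \<and> k < m + int R" for m by (auto simp: A_def)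
  have "\<exists>w. (\<forall>b\<in>A. (\<Sum>i\<in>I. w i * z i powi b) = 0) \<and> (\<Sum>i\<in>I. w i * z i powi k) \<noteq> 0"
    if "k \<notin> A" for k
  proof -
    have "\<theta> * of_int k \<notin> \<Lambda>" using that by (simp add: A_def)
    then obtain \<mu> where "\<mu> \<in> \<Lambda>" "boundary_sum (\<theta> * of_int k - \<mu>) \<noteq> 0"
      using spectrum_maximal by blast
    moreover from this obtain l :: int where "\<mu> = \<theta> * of_int l" using lattice by blast
    ultimately show ?thesis
      by (intro exI[of _ "w l"]) (auto simp: sum_w A_def boundary_sum_difference)
  qed
  moreover have "finite I" "\<And>i. i \<in> I \<Longrightarrow> z i \<noteq> 0" by (auto simp: I_def z_def)
  ultimately have "\<exists>k p. p > 0 \<and> (\<forall>j<2 * n. k + int j * p \<in> A)"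
    using gaps by (intro syndetic_zero_set_contains_progression)
  then obtain k p where p: "p > 0" and prog: "\<And>j. j < 2 * n \<Longrightarrow> k + int j * p \<in> A"
    by blast
  \<comment> \<open>The step of the progression inside the spectrum, shown below to be an integer.\<close>
  define d where "d = \<theta> * of_int p"
  have "(\<Sum>j=1..n. cis (2 * pi * d * (a j + r j)) ^ i) = (\<Sum>j=1..n. cis (2 * pi * d * a j) ^ i)"
    if "i < 2 * n" for i
  proof -
    have "boundary_sum (\<theta> * of_int (k + int i * p) - \<theta> * of_int (k + int 0 * p)) = 0"
      using prog[of i] prog[of 0] that by (intro boundary_sum_difference) (auto simp: A_def)
    then have "boundary_sum (real i * d) = 0" by (simp add: d_def algebra_simps)
    then show ?thesis by (simp add: boundary_sum_def sum_subtractf Complex.DeMoivre mult_ac)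
  qed
  then have "(\<Prod>j=1..n. cis (2 * pi * d * (a j + r j))) = (\<Prod>j=1..n. cis (2 * pi * d * a j))"
    by (intro prod_eq_if_power_sums_eq) auto
  then have "(\<Prod>j=1..n. cis (2 * pi * d * r j)) * (\<Prod>j=1..n. cis (2 * pi * d * a j)) = (\<Prod>j=1..n. cis (2 * pi * d * a j))"
    by (simp add: prod.distrib[symmetric] cis_mult algebra_simps)
  then have "(\<Prod>j=1..n. cis (2 * pi * d * r j)) = 1" by simp
  moreover have "(\<Prod>j\<in>J. cis (2 * pi * d * r j)) = cis (2 * pi * d * (\<Sum>j\<in>J. r j))" for J
    by (induction J rule: infinite_finite_induct) (auto simp: cis_mult algebra_simps)
  ultimately have "cis (2 * pi * d) = 1" using r_sum by simp
  then obtain q :: int where "2 * pi * d = of_int q * (2 * pi)" by (auto simp: cis_eq_1_iff)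
  then have "d = of_int q" by simp
  then have "\<theta> = of_int q / of_int p" using p by (simp add: d_def field_simps)
  then show ?thesis by simp
qed

end

theorem theorem4p5:
  fixes n :: nat and a r :: "nat \<Rightarrow> real" and \<Omega> \<Lambda> L :: "real set"
  assumes "n \<ge> 1"
    and "\<Omega> = (\<Union>j\<in>{1..n}. {a j ..< a j + r j})"
    and "\<And>j. 1 \<le> j \<Longrightarrow> j \<le> n \<Longrightarrow> r j > 0"
    and "(\<Sum>j=1..n. r j) = 1"
    and "\<And>j. 1 \<le> j \<Longrightarrow> j < n \<Longrightarrow> a j + r j < a (j + 1)"
    and "is_spectrum \<Omega> \<Lambda>"
    and "0 \<in> \<Lambda>"
    and "\<Lambda> \<subseteq> difference_set \<Lambda>"
    and "difference_set \<Lambda> \<subseteq> L"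
    and "is_lattice L"
  shows "\<Lambda> \<subseteq> \<rat>"
proof -
  interpret spectral_intervals n a r \<Omega> \<Lambda>
    using assms by unfold_locales auto
  obtain \<theta> where \<theta>: "\<theta> > 0" "L = {\<theta> * of_int k |k::int. True}"
    using assms(10) by (auto simp: is_lattice_def)
  then have lattice: "\<Lambda> \<subseteq> range (\<lambda>k::int. \<theta> * of_int k)" using assms(8,9) by blast
  then have "\<theta> \<in> \<rat>" by (rule lattice_step_rational[OF \<theta>(1)])
  with lattice show ?thesis by (auto intro!: Rats_mult)
qed

end
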